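(* For any connected graph $G$ of order $n\ge 2$, $$\alpha_{\mathrm{bn}}(G)\le \min\{\alpha_{\mathrm{bn}}(T): T\text{ is a spanning tree of }G\}\le n-1.$$
   Context: Graphs are finite and simple; $d$ is graph distance and $e(v)$ is the eccentricity of $v$ (both taken in the graph under consideration). A broadcast on a nontrivial connected graph $G=(V,E)$ is a function $f:V\to\{0,1,\dots,\operatorname{diam}(G)\}$ with $f(v)\le e(v)$ for all $v\in V$. Its weight is $\sigma(f)=\sum_{v\in V}f(v)$. Let $V_f^+=\{v\in V: f(v)>0\}$. A vertex $u$ hears $f$ from $v\in V_f^+$ if $d(u,v)\le f(v)$ (so a broadcasting vertex hears itself). A broadcast $f$ is bn-independent (boundary independent) if whenever a vertex $x$ hears $f$ from more than one vertex of $V_f^+$, then $d(x,u)\ge f(u)$ for all $u\in V_f^+$ (equivalently, $d(x,u)=f(u)$ for every $u\in V_f^+$ from which $x$ hears $f$). $\alpha_{\mathrm{bn}}(G)$ is the maximum weight of a bn-independent broadcast on $G$. *)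

theory Defs
  imports "Graph_Theory.Graph_Theory"
begin

text \<open>
  A finite simple graph is a \<open>pair_graph\<close>: finite, loopless, with a symmetric arc relation, so that
  every edge \<open>uv\<close> is represented by the two arcs \<open>(u, v)\<close> and \<open>(v, u)\<close>.
\<close>

text \<open>
  The length of a shortest walk. Unspecified if \<open>v\<close> is not reachable from \<open>u\<close>; it is only used for
  connected graphs.
\<close>

definition graph_dist :: "'a pair_pre_digraph \<Rightarrow> 'a \<Rightarrow> 'a \<Rightarrow> nat" where
  "graph_dist G u v = (LEAST k. \<exists>p. pre_digraph.awalk (with_proj G) u p v \<and> length p = k)"

definition eccentricity :: "'a pair_pre_digraph \<Rightarrow> 'a \<Rightarrow> nat" where
  "eccentricity G v = Max ((\<lambda>u. graph_dist G v u) ` pverts G)"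

definition graph_diam :: "'a pair_pre_digraph \<Rightarrow> nat" where
  "graph_diam G = Max (eccentricity G ` pverts G)"

definition broadcast :: "'a pair_pre_digraph \<Rightarrow> ('a \<Rightarrow> nat) \<Rightarrow> bool" where
  "broadcast G f \<longleftrightarrow>
     f \<in> pverts G \<rightarrow> {0..graph_diam G} \<and> (\<forall>v \<in> pverts G. f v \<le> eccentricity G v)"

definition broadcast_weight :: "'a pair_pre_digraph \<Rightarrow> ('a \<Rightarrow> nat) \<Rightarrow> nat" where
  "broadcast_weight G f = (\<Sum>v \<in> pverts G. f v)"

definition broadcasting :: "'a pair_pre_digraph \<Rightarrow> ('a \<Rightarrow> nat) \<Rightarrow> 'a set" where
  "broadcasting G f = {v \<in> pverts G. f v > 0}"

definition hears :: "'a pair_pre_digraph \<Rightarrow> ('a \<Rightarrow> nat) \<Rightarrow> 'a \<Rightarrow> 'a \<Rightarrow> bool" where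
  "hears G f u v \<longleftrightarrow> v \<in> broadcasting G f \<and> graph_dist G u v \<le> f v"

definition bn_independent :: "'a pair_pre_digraph \<Rightarrow> ('a \<Rightarrow> nat) \<Rightarrow> bool" where
  "bn_independent G f \<longleftrightarrow>
     (\<forall>x \<in> pverts G. (\<exists>v w. v \<noteq> w \<and> hears G f x v \<and> hears G f x w) \<longrightarrow>
        (\<forall>u \<in> broadcasting G f. graph_dist G x u \<ge> f u))"

text \<open>
  The values of \<open>f\<close> outside the vertex set are irrelevant to all of the above, so broadcasts need not
  be normalised there: the set of weights below is finite, and it contains the weight of the zero
  broadcast.
\<close>

definition alpha_bn :: "'a pair_pre_digraph \<Rightarrow> nat" where
  "alpha_bn G = Max {broadcast_weight G f | f. broadcast G f \<and> bn_independent G f}"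

text \<open>
  The predicates \<open>forest\<close>, \<open>tree\<close> and \<open>spanning_tree\<close> of the library treat \<open>a, b, a\<close> as a cycle,
  so a symmetric digraph with an edge never satisfies them. The cycles of the undirected graph
  are the directed cycles of length at least 3.
\<close>

definition undirected_tree :: "'a pair_pre_digraph \<Rightarrow> bool" where
  "undirected_tree T \<longleftrightarrow> pair_graph T \<and> connected (with_proj T) \<and>
     (\<nexists>p. pre_digraph.cycle (with_proj T) p \<and> length p \<ge> 3)"

definition undirected_spanning_tree :: "'a pair_pre_digraph \<Rightarrow> 'a pair_pre_digraph \<Rightarrow> bool" where
  "undirected_spanning_tree T G \<longleftrightarrow>
     undirected_tree T \<and> spanning (with_proj T) (with_proj G)"

end

theory Submission
  imports Defs
begin

text \<open>
  Distances only grow when passing to a spanning tree, so a bn-independent broadcast on \<open>G\<close> is also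
  one on every spanning tree. The second bound holds for all connected graphs: by bn-independence
  the open balls \<open>{x. d(x, v) < f(v)}\<close> around the broadcasting vertices are disjoint, each has at
  least \<open>f(v)\<close> elements, and a vertex at distance exactly \<open>f(v)\<close> from a broadcasting \<open>v\<close> lies in no
  open ball.
\<close>

section \<open>Distances and eccentricities in a connected graph\<close>

locale connected_pair_graph = pair_graph +
  assumes connected: "connected (with_proj G)"
begin

abbreviation d where "d \<equiv> graph_dist G"

lemma strongly_connected: "strongly_connected (with_proj G)"
  using symmetric_connected_imp_strongly_connected[OF pair_sym_arcs connected] .

lemma pverts_nonempty: "pverts G \<noteq> {}"
  using strongly_connected by (simp add: strongly_connected_def)

lemma ex_awalk:
  assumes "u \<in> pverts G" "v \<in> pverts G"
  shows "\<exists>p. awalk u p v"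
  using strongly_connected assms by (auto simp: strongly_connected_def reachable_awalk)

lemma graph_dist_le: "awalk u p v \<Longrightarrow> d u v \<le> length p"
  unfolding graph_dist_def by (rule Least_le) blast

lemma shortest_awalk:
  assumes "u \<in> pverts G" "v \<in> pverts G"
  obtains p where "awalk u p v" "length p = d u v"
  using LeastI_ex[of "\<lambda>k. \<exists>p. awalk u p v \<and> length p = k"] ex_awalk[OF assms]
  unfolding graph_dist_def by blast

text \<open>Arcs come in symmetric pairs, so a shortest walk can be reversed without changing its
  length.\<close>

lemma graph_dist_commute:
  assumes "u \<in> pverts G" "v \<in> pverts G"
  shows "d u v = d v u"
proof -
  have le: "d u v \<le> d v u" if verts: "u \<in> pverts G" "v \<in> pverts G" for u v
  proof -
    obtain p where p: "awalk v p u" "length p = d v u" using shortest_awalk verts by blast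
    have "length (rev_path q) = length q" for q :: "('a \<times> 'a) awalk" by (induct q) auto
    moreover have "awalk u (rev_path p) v" using p by simp
    ultimately show ?thesis using graph_dist_le p by metis
  qed
  show ?thesis using le assms by (simp add: antisym)
qed

text \<open>A discrete intermediate value property: along a shortest walk to \<open>v\<close> the
  distance to \<open>v\<close> drops by exactly one per arc. The induction moves \<open>u\<close>
  along such a walk until the distance is \<open>k\<close>.\<close>

lemma graph_dist_attains:
  assumes "u \<in> pverts G" "v \<in> pverts G" "k \<le> d u v"
  shows "\<exists>x \<in> pverts G. d x v = k"
  using assms
proof (induct "d u v - k" arbitrary: u)
  case 0
  then show ?case by force
next
  case (Suc n)
  obtain p where p: "awalk u p v" "length p = d u v" using shortest_awalk Suc.prems by blast
  then obtain e es where "p = e # es" using Suc.hyps(2) by (cases p) auto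
  then have e: "e \<in> parcs G" "u = fst e" "awalk (snd e) es v" "Suc (length es) = d u v"
    using p by (auto simp: awalk_Cons_iff)
  have x: "snd e \<in> pverts G" using e by (simp add: arc_snd_in_verts)
  obtain q where q: "awalk (snd e) q v" "length q = d (snd e) v"
    using shortest_awalk x Suc.prems by blast
  \<comment> \<open>Prepending \<open>e\<close> to a shortest walk from \<open>snd e\<close> gives
    this direction; the tail \<open>es\<close> gives the converse.\<close>
  have "d u v \<le> Suc (d (snd e) v)"
    using graph_dist_le[of u "e # q" v] e q by (simp add: awalk_Cons_iff)
  then have "Suc (d (snd e) v) = d u v" using graph_dist_le[OF e(3)] e(4) by simp
  with Suc show ?case
    using x by (metis Suc_inject Suc_diff_le diff_is_0_eq nat.distinct(1) not_less_eq_eq)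
qed

lemma eccentricity_attained:
  assumes "v \<in> pverts G"
  obtains u where "u \<in> pverts G" "d v u = eccentricity G v"
proof -
  have "eccentricity G v \<in> d v ` pverts G"
    unfolding eccentricity_def using pverts_nonempty by (intro Max_in) auto
  then show ?thesis using that by auto
qed

lemma graph_dist_attains_eccentricity:
  assumes "v \<in> pverts G" "k \<le> eccentricity G v"
  shows "\<exists>x \<in> pverts G. d x v = k"
proof -
  obtain u where "u \<in> pverts G" "d v u = eccentricity G v" by (rule eccentricity_attained[OF assms(1)])
  then show ?thesis using assms graph_dist_attains[of u v k] by (simp add: graph_dist_commute)
qed

section \<open>The weight bound by disjoint open balls\<close>

lemma bn_independent_weight_le:
  assumes f: "broadcast G f" and indep: "bn_independent G f"
  shows "broadcast_weight G f \<le> card (pverts G) - 1"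
proof (cases "broadcasting G f = {}")
  case True
  then show ?thesis by (simp add: broadcasting_def broadcast_weight_def)
next
  case False
  let ?S = "broadcasting G f"
  define B where "B v = {x \<in> pverts G. d x v < f v}" for v
  have S: "v \<in> pverts G" "f v \<le> eccentricity G v" if "v \<in> ?S" for v
    using that f by (auto simp: broadcasting_def broadcast_def)
  have finS: "finite ?S" by (simp add: broadcasting_def)
  have finB: "finite (B v)" for v by (simp add: B_def)
  \<comment> \<open>The ball around \<open>w\<close> is taken closed here, so that the same fact
    yields both the disjointness of the open balls and the exclusion of a boundary vertex.\<close>
  have notin_ball: "x \<notin> B v" if "x \<in> pverts G" "v \<in> ?S" "w \<in> ?S" "v \<noteq> w" "d x w \<le> f w" for x v w
  proof
    assume "x \<in> B v"
    then have "d x v < f v" by (simp add: B_def)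
    moreover from this have "hears G f x v" "hears G f x w" using that by (auto simp: hears_def)
    then have "f v \<le> d x v" using indep that unfolding bn_independent_def by blast
    ultimately show False by simp
  qed
  have card_B: "f v \<le> card (B v)" if v: "v \<in> ?S" for v
  proof -
    \<comment> \<open>Since \<open>f v\<close> is at most the eccentricity of \<open>v\<close>, each
      of the \<open>f v\<close> distances below \<open>f v\<close> is attained, necessarily inside
      the ball.\<close>
    have "{..<f v} \<subseteq> (\<lambda>x. d x v) ` B v"
    proof
      fix k assume "k \<in> {..<f v}"
      then have "\<exists>x \<in> pverts G. d x v = k"
        using S[OF v] by (intro graph_dist_attains_eccentricity) auto
      with \<open>k \<in> {..<f v}\<close> show "k \<in> (\<lambda>x. d x v) ` B v" by (auto simp: B_def)
    qed
    then have "card {..<f v} \<le> card (B v)" by (rule surj_card_le[OF finB])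
    then show ?thesis by simp
  qed
  have "broadcast_weight G f = (\<Sum>v\<in>?S. f v)"
    unfolding broadcast_weight_def by (rule sum.mono_neutral_right) (auto simp: broadcasting_def)
  also have "\<dots> \<le> (\<Sum>v\<in>?S. card (B v))" using card_B by (rule sum_mono)
  also have "\<dots> = card (\<Union>v\<in>?S. B v)"
  proof (rule card_UN_disjoint[symmetric])
    show "\<forall>v\<in>?S. \<forall>w\<in>?S. v \<noteq> w \<longrightarrow> B v \<inter> B w = {}"
      using notin_ball unfolding B_def by fastforce
  qed (auto simp: finS finB)
  also have "\<dots> \<le> card (pverts G) - 1"
  proof -
    obtain v where v: "v \<in> ?S" using False by blast
    \<comment> \<open>This boundary vertex of one ball is missed by all of them, which accounts for
      the \<open>- 1\<close>.\<close>
    obtain y where y: "y \<in> pverts G" "d y v = f v"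
      using graph_dist_attains_eccentricity S[OF v] by blast
    have "y \<notin> B w" if "w \<in> ?S" for w
    proof (cases "w = v")
      case True
      then show ?thesis using y by (simp add: B_def)
    next
      case False
      then show ?thesis using notin_ball[of y w v] v y that by simp
    qed
    then have "(\<Union>v\<in>?S. B v) \<subseteq> pverts G - {y}" by (auto simp: B_def)
    then have "card (\<Union>v\<in>?S. B v) \<le> card (pverts G - {y})" by (intro card_mono) auto
    then show ?thesis using y by simp
  qed
  finally show ?thesis .
qed

text \<open>Needed for \<open>Max\<close> in \<open>alpha_bn\<close> to be meaningful: the functions
  are unconstrained outside \<open>pverts G\<close>, but their weights are bounded.\<close>

lemma finite_bn_independent_weights:
  "finite {broadcast_weight G f | f. broadcast G f \<and> bn_independent G f}"
  by (rule finite_subset[of _ "{..card (pverts G) - 1}"]) (auto dest: bn_independent_weight_le)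

lemma bn_independent_weights_nonempty:
  "{broadcast_weight G f | f. broadcast G f \<and> bn_independent G f} \<noteq> {}"
proof -
  have "broadcast G (\<lambda>_. 0)" "bn_independent G (\<lambda>_. 0)"
    by (auto simp: broadcast_def bn_independent_def hears_def broadcasting_def)
  then show ?thesis by blast
qed

lemma alpha_bn_le: "alpha_bn G \<le> card (pverts G) - 1"
  unfolding alpha_bn_def using finite_bn_independent_weights bn_independent_weights_nonempty
  by (subst Max_le_iff) (auto dest: bn_independent_weight_le)

section \<open>Passing to a connected spanning subgraph\<close>

lemma graph_dist_spanning:
  assumes "connected_pair_graph T" "spanning (with_proj T) (with_proj G)"
    and "u \<in> pverts G" "v \<in> pverts G"
  shows "d u v \<le> graph_dist T u v"
proof -
  interpret T: connected_pair_graph T by fact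
  have "pverts T = pverts G" "subgraph (with_proj T) (with_proj G)"
    using assms(2) by (auto simp: spanning_def)
  then show ?thesis
    using assms(3,4) T.shortest_awalk[of u v] graph_dist_le subgraph_awalk_imp_awalk by metis
qed

text \<open>Larger distances work in favour of every condition: eccentricities and diameter grow, so
  the caps on \<open>f\<close> persist; hearing in \<open>T\<close> implies hearing in
  \<open>G\<close>, so the premise of independence gets stronger, and its conclusion, a lower bound
  on distances, survives.\<close>

lemma bn_independent_spanning:
  assumes T: "connected_pair_graph T" and span: "spanning (with_proj T) (with_proj G)"
    and f: "broadcast G f" and indep: "bn_independent G f"
  shows "broadcast T f \<and> bn_independent T f"
proof
  interpret T: connected_pair_graph T by fact
  have V: "pverts T = pverts G" using span by (auto simp: spanning_def)
  note dist = graph_dist_spanning[OF T span]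
  have ecc: "eccentricity G v \<le> eccentricity T v" if v: "v \<in> pverts G" for v
  proof -
    obtain u where u: "u \<in> pverts G" "d v u = eccentricity G v" using eccentricity_attained v by blast
    have "graph_dist T v u \<le> eccentricity T v" unfolding eccentricity_def using u V by (intro Max_ge) auto
    then show ?thesis using dist[OF v u(1)] u(2) by simp
  qed
  \<comment> \<open>Diameters are compared through a vertex whose eccentricity realises the diameter
    of \<open>G\<close>.\<close>
  have "graph_diam G \<in> eccentricity G ` pverts G"
    unfolding graph_diam_def using pverts_nonempty by (intro Max_in) auto
  then obtain v where v: "v \<in> pverts G" "graph_diam G = eccentricity G v" by auto
  have "eccentricity T v \<le> graph_diam T" unfolding graph_diam_def using v V by (intro Max_ge) auto
  with ecc v have diam: "graph_diam G \<le> graph_diam T" by fastforce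
  show "broadcast T f"
    unfolding broadcast_def
  proof (intro conjI ballI Pi_I)
    fix v assume "v \<in> pverts T"
    then have v: "v \<in> pverts G" using V by simp
    show "f v \<in> {0..graph_diam T}" using f v diam by (auto simp: broadcast_def Pi_iff intro: order_trans)
    show "f v \<le> eccentricity T v" using f v ecc[OF v] by (auto simp: broadcast_def intro: order_trans)
  qed
  have S: "broadcasting T f = broadcasting G f" by (simp add: broadcasting_def V)
  have SV: "v \<in> pverts G" if "v \<in> broadcasting G f" for v using that by (simp add: broadcasting_def)
  have hears: "hears G f x v" if "hears T f x v" "x \<in> pverts G" for x v
    using that dist SV unfolding hears_def S by (meson order_trans)
  show "bn_independent T f"
    unfolding bn_independent_def
  proof (intro ballI impI)
    fix x u
    assume x: "x \<in> pverts T" and "\<exists>v w. v \<noteq> w \<and> hears T f x v \<and> hears T f x w"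
      and u: "u \<in> broadcasting T f"
    then have "\<exists>v w. v \<noteq> w \<and> hears G f x v \<and> hears G f x w" using hears V by blast
    then have "f u \<le> d x u" using indep x u V S unfolding bn_independent_def by blast
    also have "\<dots> \<le> graph_dist T x u" using dist x u V S SV by simp
    finally show "f u \<le> graph_dist T x u" .
  qed
qed

lemma alpha_bn_le_spanning:
  assumes T: "connected_pair_graph T" and span: "spanning (with_proj T) (with_proj G)"
  shows "alpha_bn G \<le> alpha_bn T"
  unfolding alpha_bn_def
proof (rule Max_mono)
  have "broadcast_weight T f = broadcast_weight G f" for f
    using span by (simp add: broadcast_weight_def spanning_def)
  then show "{broadcast_weight G f | f. broadcast G f \<and> bn_independent G f} \<subseteq>
    {broadcast_weight T f | f. broadcast T f \<and> bn_independent T f}"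
    using bn_independent_spanning[OF T span] by fastforce
qed (use bn_independent_weights_nonempty connected_pair_graph.finite_bn_independent_weights[OF T] in auto)

section \<open>Existence of spanning trees\<close>

text \<open>The rest of the cycle is a detour around the deleted edge. The length condition excludes
  the closed walk a, b, a, whose rest is the deleted arc \<open>(b, a)\<close> itself.\<close>

lemma connected_del_edge:
  assumes cyc: "cycle ((a, b) # es)" and len: "length es \<ge> 2"
  shows "connected_pair_graph \<lparr>pverts = pverts G, parcs = parcs G - {(a, b), (b, a)}\<rparr>"
proof -
  let ?H = "\<lparr>pverts = pverts G, parcs = parcs G - {(a, b), (b, a)}\<rparr>"
  interpret H: pair_graph ?H
    by unfold_locales
      (auto simp: wellformed' no_loops' symmetric_def sym_def arcs_symmetric dest: wellformed')
  have path: "apath b es a"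
    using cyc by (auto simp: cycle_def apath_def awalk_Cons_iff)
  \<comment> \<open>The detour has to avoid both deleted arcs. Its first arc \<open>(b, x)\<close>
    does because \<open>x\<close> is neither \<open>a\<close> nor \<open>b\<close>; the later arcs
    do because a path never returns to \<open>b\<close>.\<close>
  obtain x es' where es: "es = (b, x) # es'"
    using len path by (cases es) (auto simp: apath_Cons_iff)
  have path': "apath x es' a" and b: "b \<notin> set (awalk_verts x es')" and "es' \<noteq> []"
    using path len unfolding es by (auto simp: apath_Cons_iff)
  have "x \<noteq> a" using apath_nonempty_ends[OF path' \<open>es' \<noteq> []\<close>] .
  have "x \<noteq> b" using b path' hd_in_awalk_verts(2) by blast
  have "fst e \<noteq> b \<and> snd e \<noteq> b" if "e \<in> set es'" for e
    using that b awalk_verts_arc1 awalk_verts_arc2 awalkI_apath[OF path'] by metis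
  then have "(a, b) \<notin> set es'" "(b, a) \<notin> set es'" by force+
  then have "set es \<subseteq> parcs ?H"
    using path \<open>x \<noteq> a\<close> \<open>x \<noteq> b\<close> unfolding es by (auto simp: apath_def awalk_def)
  then have "H.awalk b es a" using path by (auto simp: apath_def awalk_def H.awalk_def)
  then have ba: "b \<rightarrow>\<^sup>*\<^bsub>with_proj ?H\<^esub> a" by (auto simp: H.reachable_awalk)
  then have ab: "a \<rightarrow>\<^sup>*\<^bsub>with_proj ?H\<^esub> b" by (rule H.symmetric_reachable')
  have reach: "u \<rightarrow>\<^sup>*\<^bsub>with_proj ?H\<^esub> v" if "u \<rightarrow>\<^sup>*\<^bsub>with_proj G\<^esub> v" for u v
    using that
  proof (induct rule: reachable_induct)
    case base
    then show ?case using that by (auto dest: reachable_in_verts)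
  next
    case (step v w)
    \<comment> \<open>An arc of \<open>G\<close> either survives or is replaced by the detour in the
      appropriate direction.\<close>
    have "v \<rightarrow>\<^sup>*\<^bsub>with_proj ?H\<^esub> w"
    proof (cases "(v, w) \<in> parcs ?H")
      case True
      then show ?thesis by (intro H.reachable_adjI) simp
    next
      case False
      then show ?thesis using ab ba step by auto
    qed
    with step show ?case using H.reachable_trans by blast
  qed
  have "strongly_connected (with_proj ?H)"
    using strongly_connected reach by (auto simp: strongly_connected_def)
  then have "connected (with_proj ?H)"
    by (auto simp: connected_def strongly_connected_def intro: H.reachable_mk_symmetricI)
  then show ?thesis by unfold_locales
qed

end

text \<open>Edges on cycles of length at least 3 are deleted until no such cycle is left; the number
  of arcs strictly decreases.\<close>

lemma undirected_spanning_tree_exists: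
  assumes "connected_pair_graph G"
  shows "\<exists>T. undirected_spanning_tree T G"
  using assms
proof (induct "card (parcs G)" arbitrary: G rule: less_induct)
  case less
  interpret connected_pair_graph G by fact
  show ?case
  proof (cases "\<exists>p. cycle p \<and> length p \<ge> 3")
    case False
    then have "undirected_spanning_tree G G"
      using connected pair_graph subgraph_refl
      by (auto simp: undirected_spanning_tree_def undirected_tree_def spanning_def)
    then show ?thesis by blast
  next
    case True
    then obtain p where p: "cycle p" "length p \<ge> 3" by blast
    then obtain a b es where p_eq: "p = (a, b) # es" by (cases p) auto
    let ?H = "\<lparr>pverts = pverts G, parcs = parcs G - {(a, b), (b, a)}\<rparr>"
    have H: "connected_pair_graph ?H" using p by (intro connected_del_edge) (auto simp: p_eq)
    interpret H: connected_pair_graph ?H by (fact H)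
    have "(a, b) \<in> parcs G" using p by (auto simp: p_eq cycle_def awalk_Cons_iff)
    then have "card (parcs ?H) < card (parcs G)" by (intro psubset_card_mono) auto
    then obtain T where T: "undirected_spanning_tree T ?H" using less.hyps H by blast
    have "subgraph (with_proj ?H) (with_proj G)"
      by (rule subgraphI) (auto simp: H.wf_digraph wf_digraph)
    then have "undirected_spanning_tree T G"
      using T subgraph_trans by (auto simp: undirected_spanning_tree_def spanning_def)
    then show ?thesis by blast
  qed
qed

theorem corollary2p6:
  fixes G :: "'a pair_pre_digraph"
  assumes "pair_graph G" and "connected (with_proj G)" and "card (pverts G) \<ge> 2"
  shows "alpha_bn G \<le> Min {alpha_bn T | T. undirected_spanning_tree T G} \<and>
         Min {alpha_bn T | T. undirected_spanning_tree T G} \<le> card (pverts G) - 1"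
proof -
  interpret connected_pair_graph G
    using assms by (simp add: connected_pair_graph_def connected_pair_graph_axioms_def)
  let ?A = "{alpha_bn T | T. undirected_spanning_tree T G}"
  have T: "connected_pair_graph T" "spanning (with_proj T) (with_proj G)" "pverts T = pverts G"
    if "undirected_spanning_tree T G" for T
    using that by (auto simp: undirected_spanning_tree_def undirected_tree_def spanning_def
        connected_pair_graph_def connected_pair_graph_axioms_def)
  \<comment> \<open>The weight bound applies to each tree, which has as many vertices as
    \<open>G\<close>. It gives the second inequality and also the finiteness that \<open>Min\<close>
    requires.\<close>
  have bound: "a \<le> card (pverts G) - 1" if "a \<in> ?A" for a
    using that T connected_pair_graph.alpha_bn_le by fastforce
  then have fin: "finite ?A" by (intro finite_subset[of ?A "{..card (pverts G) - 1}"]) auto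
  have ne: "?A \<noteq> {}"
    using undirected_spanning_tree_exists[OF connected_pair_graph_axioms] by blast
  have "alpha_bn G \<le> Min ?A"
    using fin ne T alpha_bn_le_spanning by (subst Min_ge_iff) auto
  moreover have "Min ?A \<le> card (pverts G) - 1" using bound Min_in[OF fin ne] .
  ultimately show ?thesis ..
qed

end
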